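(* Suppose $\widehat H_\diamond\in\mathcal A^\rho\cap\mathcal F_\diamond$ for some $\rho>0$. Then $\phi^\delta(\widehat H_\diamond)\in\mathcal A^{g(\delta)}\cap\mathcal F_\diamond$ for any $\delta\ge0$, where for some constants $A,B>0$ $$g(\delta)\ge\frac{A}{1+B\delta}\qquad\text{for all }\delta\ge0.$$
   Context: Let $n\ge1$ and let $\omega\in\mathbb R^n$ be nonresonant: $\langle q,\omega\rangle\ne0$ for all $q\in\mathbb Z^n\setminus\{0\}$. Let $z=(z_1,\dots,z_n)$, $\overline z=(\overline z_1,\dots,\overline z_n)$ be independent complex variables (the bar is not complex conjugation), $\mathbf z=(z,\overline z)$. For $\mathbf k=(k,\overline k)\in\mathbb Z_+^{2n}$ put $\mathbf k'=\overline k-k\in\mathbb Z^n$, let $|\mathbf k|$ be the sum of all components, $\mathbf z^{\mathbf k}=z^k\overline z^{\overline k}$. Let $\mathcal F$ be the space of all formal power series in $\mathbf z$ with complex coefficients and $\mathcal F_\diamond\subset\mathcal F$ the subspace of series $H_\diamond=\sum_{|\mathbf k|\ge3}H_{\mathbf k}\mathbf z^{\mathbf k}$. For $\rho>0$ let $D_\rho=\{\mathbf z\in\mathbb C^{2n}:|z_j|<\rho,\ |\overline z_j|<\rho,\ j=1,\dots,n\}$, and let $\mathcal A^\rho\subset\mathcal F$ be the Banach space of power series that converge to an analytic function in $D_\rho$ with finite norm $\|H\|_\rho=\sup_{\mathbf z\in D_\rho}|H(\mathbf z)|$. Put $H_2=\sum_j\omega_jz_j\overline z_j$, $\{F,G\}=i\sum_{j=1}^n(\partial_{\overline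 z_j}F\,\partial_{z_j}G-\partial_{z_j}F\,\partial_{\overline z_j}G)$, and $\xi H_\diamond=-i\sum_{|\mathbf k|\ge3}\sigma_{\mathbf k'}H_{\mathbf k}\mathbf z^{\mathbf k}$, where $\sigma_q=\operatorname{sign}\langle\omega,q\rangle$ for $q\in\mathbb Z^n$ ($\sigma_0=0$). For $\widehat H_\diamond\in\mathcal F_\diamond$ and $\delta\ge0$, $\phi^\delta(\widehat H_\diamond)$ denotes the value at $\delta$ of the (unique, existing for all $\delta\ge0$) solution in $\mathcal F_\diamond$ of $$\partial_\delta H_\diamond=-\{\xi H_\diamond,H_2+H_\diamond\},\qquad H_\diamond|_{\delta=0}=\widehat H_\diamond,$$ understood as an infinite ODE system for the coefficients $H_{\mathbf k}(\delta)$. The constants $A,B$ may depend on $\widehat H_\diamond$ but not on $\delta$. *)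

theory Defs
  imports "HOL-Analysis.Analysis"
begin

text \<open>
  Throughout, \<open>'n\<close> is a finite index type, \<open>n = CARD('n) \<ge> 1\<close>.  A multi-index
  \<open>\<^bold>k = (k, kbar)\<close> in \<open>Z\<^sub>+\<^sup>2\<^sup>n\<close> and a point \<open>\<^bold>z = (z, zbar)\<close> in \<open>C\<^sup>2\<^sup>n\<close> are pairs
  whose second component belongs to the barred variables (which are independent of the
  unbarred ones).  A formal power series is its family of coefficients.
\<close>

type_synonym 'n mindex = "(nat, 'n) vec \<times> (nat, 'n) vec"
type_synonym 'n point = "(complex, 'n) vec \<times> (complex, 'n) vec"
type_synonym 'n series = "'n mindex \<Rightarrow> complex"

definition pairing :: "real ^ 'n \<Rightarrow> int ^ 'n \<Rightarrow> real" where
  "pairing \<omega> q = (\<Sum>j\<in>UNIV. \<omega> $ j * of_int (q $ j))"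

definition nonresonant :: "real ^ 'n \<Rightarrow> bool" where
  "nonresonant \<omega> \<longleftrightarrow> (\<forall>q. q \<noteq> 0 \<longrightarrow> pairing \<omega> q \<noteq> 0)"

definition mdegree :: "'n::finite mindex \<Rightarrow> nat" where
  "mdegree k = (\<Sum>j\<in>UNIV. fst k $ j + snd k $ j)"

definition mdiff :: "'n::finite mindex \<Rightarrow> int ^ 'n" where
  "mdiff k = (\<chi> j. int (snd k $ j) - int (fst k $ j))"

definition monomial :: "'n::finite point \<Rightarrow> 'n mindex \<Rightarrow> complex" where
  "monomial z k = (\<Prod>j\<in>UNIV. (fst z $ j) ^ (fst k $ j) * (snd z $ j) ^ (snd k $ j))"

definition F_diamond :: "'n::finite series set" where
  "F_diamond = {H. \<forall>k. mdegree k < 3 \<longrightarrow> H k = 0}"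

definition polydisc :: "real \<Rightarrow> 'n::finite point set" where
  "polydisc \<rho> = {z. \<forall>j. cmod (fst z $ j) < \<rho> \<and> cmod (snd z $ j) < \<rho>}"

text \<open>
  Convergence of a multiple power series is unconditional (for complex terms: absolute)
  convergence at every point of the open polydisc; the sum is then automatically analytic
  there, so only finiteness of the supremum norm has to be demanded in addition.
\<close>

definition series_eval :: "'n::finite series \<Rightarrow> 'n point \<Rightarrow> complex" where
  "series_eval H z = (\<Sum>\<^sub>\<infinity>k. H k * monomial z k)"

definition A_space :: "real \<Rightarrow> 'n::finite series set" where
  "A_space \<rho> = {H. (\<forall>z\<in>polydisc \<rho>. (\<lambda>k. H k * monomial z k) summable_on UNIV) \<and>
                   bdd_above ((\<lambda>z. cmod (series_eval H z)) ` polydisc \<rho>)}"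

definition series_mult :: "'n::finite series \<Rightarrow> 'n series \<Rightarrow> 'n series" where
  "series_mult F G = (\<lambda>k. \<Sum>(a, b)\<in>{(a, b). a + b = k}. F a * G b)"

lemma finite_mindex_splittings: "finite {(a, b). a + b = (k :: 'n::finite mindex)}"
proof -
  have fv: "finite {v :: nat ^ 'n. \<forall>j. v $ j \<le> w $ j}" for w
  proof -
    have "finite (PiE UNIV (\<lambda>j. {..w $ j}))"
      by (intro finite_PiE) auto
    moreover have "{v :: nat ^ 'n. \<forall>j. v $ j \<le> w $ j} \<subseteq> vec_lambda ` PiE UNIV (\<lambda>j. {..w $ j})"
    proof
      fix v :: "nat ^ 'n" assume "v \<in> {v. \<forall>j. v $ j \<le> w $ j}"
      then have "vec_nth v \<in> PiE UNIV (\<lambda>j. {..w $ j})" by auto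
      then show "v \<in> vec_lambda ` PiE UNIV (\<lambda>j. {..w $ j})"
        by (metis image_eqI vec_nth_inverse)
    qed
    ultimately show ?thesis by (meson finite_imageI finite_subset)
  qed
  let ?S = "{v :: nat ^ 'n. \<forall>j. v $ j \<le> fst k $ j} \<times> {v :: nat ^ 'n. \<forall>j. v $ j \<le> snd k $ j}"
  have "{(a, b). a + b = k} \<subseteq> ?S \<times> ?S" by auto
  moreover have "finite (?S \<times> ?S)" using fv by blast
  ultimately show ?thesis by (rule finite_subset)
qed

definition deriv_z :: "'n::finite \<Rightarrow> 'n series \<Rightarrow> 'n series" where
  "deriv_z j F = (\<lambda>k. of_nat (fst k $ j + 1) * F (k + (axis j 1, 0)))"

definition deriv_zbar :: "'n::finite \<Rightarrow> 'n series \<Rightarrow> 'n series" where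
  "deriv_zbar j F = (\<lambda>k. of_nat (snd k $ j + 1) * F (k + (0, axis j 1)))"

definition bracket :: "'n::finite series \<Rightarrow> 'n series \<Rightarrow> 'n series" where
  "bracket F G = (\<lambda>k. \<i> * (\<Sum>j\<in>UNIV.
     series_mult (deriv_zbar j F) (deriv_z j G) k -
     series_mult (deriv_z j F) (deriv_zbar j G) k))"

definition H2 :: "real ^ 'n \<Rightarrow> 'n series" where
  "H2 \<omega> = (\<lambda>k. \<Sum>j\<in>UNIV. if k = (axis j 1, axis j 1) then of_real (\<omega> $ j) else 0)"

definition xi :: "real ^ 'n \<Rightarrow> 'n series \<Rightarrow> 'n series" where
  "xi \<omega> H = (\<lambda>k. if mdegree k \<ge> 3
                  then - \<i> * of_real (sgn (pairing \<omega> (mdiff k))) * H k else 0)"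

text \<open>
  The flow equation, required coefficientwise on \<open>[0, \<infinity>)\<close> (one-sided derivative at 0).
  A solution is a function on all of \<open>real\<close>, but its values at negative times are
  irrelevant.
\<close>

definition flow_solution :: "real ^ 'n \<Rightarrow> 'n series \<Rightarrow> (real \<Rightarrow> 'n series) \<Rightarrow> bool" where
  "flow_solution \<omega> H0 H \<longleftrightarrow>
     H 0 = H0 \<and>
     (\<forall>t\<ge>0. H t \<in> F_diamond) \<and>
     (\<forall>t\<ge>0. \<forall>k. ((\<lambda>s. H s k) has_vector_derivative
          - bracket (xi \<omega> (H t)) (\<lambda>l. H2 \<omega> l + H t l) k) (at t within {0..}))"

definition phi :: "real ^ 'n \<Rightarrow> real \<Rightarrow> 'n series \<Rightarrow> 'n series" where
  "phi \<omega> t H0 = (THE G. \<exists>H. flow_solution \<omega> H0 H \<and> H t = G)"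

end

theory Submission
  imports Defs
begin

text \<open>
  Since \<open>{\<xi>H, H\<^sub>2} = \<Sum> \<bar>\<langle>\<omega>, k'\<rangle>\<bar> H\<^sub>k z\<^sup>k\<close>, the linear part of the flow only damps the coefficients,
  while the quadratic part of degree \<open>m\<close> involves only coefficients of degree less than \<open>m\<close>,
  because all series start in degree 3.  Hence the system is triangular and is solved by
  Duhamel's formula, degree by degree.  Dropping the damping, the \<open>\<ell>\<^sup>1\<close> norms \<open>N\<^sub>m\<close> of the
  homogeneous parts satisfy an integral inequality with kernel \<open>2n \<Sum> p q N\<^sub>p N\<^sub>q\<close>,
  \<open>p + q = m + 2\<close>.  This is a Burgers-type system with the explicit majorant
  \<open>N\<^sub>r\<^sub>+\<^sub>2(t) \<le> c R\<^sup>r (1 + B t)\<^sup>r\<^sup>-\<^sup>1 / r\<^sup>3\<close>, which gives the radius \<open>1 / (2 R (1 + B t))\<close>.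
\<close>

text \<open>Quantifiers over multi-indices are to stay whole instead of being split over the two
  components.\<close>

declare split_paired_All [simp del]

section \<open>Degrees of multi-indices\<close>

lemma mdegree_add: "mdegree (a + b) = mdegree a + mdegree b"
  by (simp add: mdegree_def sum.distrib)

lemma mdegree_Pair_add: "mdegree (a + c, b + d) = mdegree (a, b) + mdegree (c, d)"
  using mdegree_add[of "(a, b)" "(c, d)"] by simp

lemma mdegree_axis [simp]: "mdegree (axis i (Suc 0), 0) = 1" "mdegree (0, axis i (Suc 0)) = 1"
  by (simp_all add: mdegree_def axis_def)

lemma mdegree_ge_components: "fst k $ j \<le> mdegree k" "snd k $ j \<le> mdegree k"
proof -
  have "fst k $ j + snd k $ j \<le> mdegree k"
    unfolding mdegree_def by (rule member_le_sum) auto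
  then show "fst k $ j \<le> mdegree k" "snd k $ j \<le> mdegree k" by auto
qed

text \<open>A multi-index of degree at most \<open>m\<close> has all entries at most
  \<open>m\<close>, so it divides the constant multi-index \<open>?K\<close> and occurs in a
  splitting of it.\<close>

lemma finite_mdegree_le: "finite {k :: 'n::finite mindex. mdegree k \<le> m}"
proof (rule finite_subset)
  let ?K = "(\<chi> j. m, \<chi> j. m) :: 'n mindex"
  show "finite (fst ` {(a, b). a + b = ?K})"
    using finite_mindex_splittings by blast
  show "{k :: 'n mindex. mdegree k \<le> m} \<subseteq> fst ` {(a, b). a + b = ?K}"
  proof
    fix k :: "'n mindex" assume "k \<in> {k. mdegree k \<le> m}"
    then have "fst k $ j \<le> m" "snd k $ j \<le> m" for j
      using mdegree_ge_components[of k j] by auto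
    then have "k + (\<chi> j. m - fst k $ j, \<chi> j. m - snd k $ j) = ?K"
      by (auto simp: prod_eq_iff vec_eq_iff)
    then show "k \<in> fst ` {(a, b). a + b = ?K}" by (intro image_eqI[of _ _ "(k, _)"]) auto
  qed
qed

lemma finite_mdegree_eq [simp]: "finite {k :: 'n::finite mindex. mdegree k = m}"
  by (rule finite_subset[OF _ finite_mdegree_le[of m]]) auto

section \<open>The \<open>\<ell>\<^sup>1\<close> norms of homogeneous parts, written
  \<open>N\<^sub>m\<close> above\<close>

definition degnorm :: "'n::finite series \<Rightarrow> nat \<Rightarrow> real" where
  "degnorm F m = (\<Sum>k | mdegree k = m. cmod (F k))"

lemma degnorm_nonneg: "0 \<le> degnorm F m"
  by (simp add: degnorm_def sum_nonneg)

lemma degnorm_sum_le: "degnorm (\<lambda>k. \<Sum>j\<in>J. F j k) m \<le> (\<Sum>j\<in>J. degnorm (F j) m)"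
proof -
  have "degnorm (\<lambda>k. \<Sum>j\<in>J. F j k) m \<le> (\<Sum>k | mdegree k = m. \<Sum>j\<in>J. cmod (F j k))"
    unfolding degnorm_def by (intro sum_mono norm_sum)
  then show ?thesis
    unfolding degnorm_def by (subst sum.swap)
qed

lemma degnorm_diff_le: "degnorm (\<lambda>k. F k - G k) m \<le> degnorm F m + degnorm G m"
  by (simp add: degnorm_def flip: sum.distrib) (intro sum_mono norm_triangle_ineq4)

text \<open>The splittings \<open>k = a + b\<close> in degree \<open>m\<close> are regrouped by the
  degree \<open>p\<close> of \<open>a\<close>.\<close>

lemma degnorm_series_mult_le:
  "degnorm (series_mult F G) m \<le> (\<Sum>p\<le>m. degnorm F p * degnorm G (m - p))"
proof -
  let ?D = "\<lambda>p. {k. mdegree k = p}"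
  let ?S = "\<lambda>k. {(a, b). a + b = k}"
  have "degnorm (series_mult F G) m \<le> (\<Sum>k\<in>?D m. \<Sum>(a, b)\<in>?S k. cmod (F a) * cmod (G b))"
    unfolding degnorm_def series_mult_def
    by (intro sum_mono order.trans[OF norm_sum]) (auto simp: norm_mult case_prod_beta)
  also have "\<dots> = (\<Sum>(k, ab)\<in>(SIGMA k:?D m. ?S k). cmod (F (fst ab)) * cmod (G (snd ab)))"
    by (subst sum.Sigma[symmetric]) (auto simp: finite_mindex_splittings case_prod_beta)
  also have "\<dots> = (\<Sum>(p, ab)\<in>(SIGMA p:{..m}. ?D p \<times> ?D (m - p)). cmod (F (fst ab)) * cmod (G (snd ab)))"
    by (rule sum.reindex_bij_witness[of _ "\<lambda>(p, (a, b)). (a + b, (a, b))"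
          "\<lambda>(k, (a, b)). (mdegree a, (a, b))"]) (auto simp: mdegree_Pair_add)
  also have "\<dots> = (\<Sum>p\<le>m. \<Sum>ab\<in>?D p \<times> ?D (m - p). cmod (F (fst ab)) * cmod (G (snd ab)))"
    by (subst sum.Sigma) auto
  also have "\<dots> = (\<Sum>p\<le>m. degnorm F p * degnorm G (m - p))"
    by (simp add: degnorm_def sum_product sum.cartesian_product case_prod_beta)
  finally show ?thesis .
qed

text \<open>Common form of both derivatives: \<open>w\<close> is the exponent brought down, at most
  \<open>Suc p\<close>, and adding \<open>e\<close> maps degree \<open>p\<close> injectively into
  degree \<open>Suc p\<close>.\<close>

lemma degnorm_shift_le:
  assumes "mdegree e = 1" and "\<And>k. mdegree k = p \<Longrightarrow> w k \<le> Suc p"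
  shows "degnorm (\<lambda>k. of_nat (w k) * F (k + e)) p \<le> real (Suc p) * degnorm F (Suc p)"
proof -
  have "degnorm (\<lambda>k. of_nat (w k) * F (k + e)) p \<le> (\<Sum>k | mdegree k = p. real (Suc p) * cmod (F (k + e)))"
    unfolding degnorm_def using assms(2)
    by (intro sum_mono) (auto simp: norm_mult simp del: of_nat_Suc intro!: mult_right_mono)
  also have "\<dots> = real (Suc p) * (\<Sum>k\<in>(\<lambda>k. k + e) ` {k. mdegree k = p}. cmod (F k))"
    by (subst sum.reindex) (auto simp: sum_distrib_left inj_on_def)
  also have "\<dots> \<le> real (Suc p) * degnorm F (Suc p)"
    unfolding degnorm_def using assms(1)
    by (intro mult_left_mono sum_mono2) (auto simp: mdegree_add)
  finally show ?thesis .
qed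

lemma degnorm_deriv_z_le: "degnorm (deriv_z j F) p \<le> real (Suc p) * degnorm F (Suc p)"
  unfolding deriv_z_def
  by (rule degnorm_shift_le) (simp, metis Suc_eq_plus1 Suc_le_mono mdegree_ge_components(1))

lemma degnorm_deriv_zbar_le: "degnorm (deriv_zbar j F) p \<le> real (Suc p) * degnorm F (Suc p)"
  unfolding deriv_zbar_def
  by (rule degnorm_shift_le) (simp, metis Suc_eq_plus1 Suc_le_mono mdegree_ge_components(2))

lemma degnorm_xi_le: "degnorm (xi \<omega> H) p \<le> degnorm H p"
  unfolding degnorm_def by (intro sum_mono) (auto simp: xi_def norm_mult sgn_if)

text \<open>Each \<open>j\<close> contributes two products, and both obey the same convolution bound
  \<open>?S\<close>, because the derivative estimates do not distinguish barred from unbarred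
  variables.\<close>

lemma degnorm_bracket_le:
  fixes F G :: "'n::finite series"
  shows "degnorm (bracket F G) m \<le> 2 * real CARD('n) *
     (\<Sum>p\<le>m. (real (Suc p) * degnorm F (Suc p)) * (real (Suc (m - p)) * degnorm G (Suc (m - p))))"
    (is "_ \<le> _ * ?S")
proof -
  have 1: "degnorm (series_mult X Y) m \<le> ?S"
    if "\<And>p. degnorm X p \<le> real (Suc p) * degnorm F (Suc p)"
       "\<And>p. degnorm Y p \<le> real (Suc p) * degnorm G (Suc p)" for X Y :: "'n series"
    by (rule order.trans[OF degnorm_series_mult_le])
       (intro sum_mono mult_mono that degnorm_nonneg mult_nonneg_nonneg of_nat_0_le_iff)
  have "degnorm (bracket F G) m
      = degnorm (\<lambda>k. \<Sum>j\<in>UNIV. series_mult (deriv_zbar j F) (deriv_z j G) k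
                          - series_mult (deriv_z j F) (deriv_zbar j G) k) m"
    by (simp add: bracket_def degnorm_def norm_mult)
  also have "\<dots> \<le> (\<Sum>j\<in>(UNIV :: 'n set). ?S + ?S)"
    by (intro order.trans[OF degnorm_sum_le] sum_mono order.trans[OF degnorm_diff_le] add_mono 1
        degnorm_deriv_z_le degnorm_deriv_zbar_le)
  also have "\<dots> = 2 * real CARD('n) * ?S" by simp
  finally show ?thesis .
qed

section \<open>The bracket with \<open>H2\<close>\<close>

lemma series_mult_add: "series_mult F (\<lambda>l. G l + K l) k = series_mult F G k + series_mult F K k"
  by (simp add: series_mult_def case_prod_beta algebra_simps sum.distrib)

lemma bracket_add: "bracket F (\<lambda>l. G l + K l) k = bracket F G k + bracket F K k"
proof -
  have "deriv_z j (\<lambda>l. G l + K l) = (\<lambda>l. deriv_z j G l + deriv_z j K l)"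
       "deriv_zbar j (\<lambda>l. G l + K l) = (\<lambda>l. deriv_zbar j G l + deriv_zbar j K l)" for j
    by (auto simp: deriv_z_def deriv_zbar_def algebra_simps)
  then show ?thesis
    by (simp add: bracket_def series_mult_add sum.distrib sum_subtractf algebra_simps)
qed

text \<open>The derivative is the single monomial \<open>\<omega>\<^sub>j zbar\<^sub>j\<close>, so
  multiplying by it only shifts and scales coefficients.\<close>

lemma deriv_z_H2: "deriv_z j (H2 \<omega>) = (\<lambda>l. if l = (0, axis j 1) then of_real (\<omega> $ j) else 0)"
proof
  fix l :: "'a mindex"
  have *: "l + (axis j 1, 0) = (axis i 1, axis i 1) \<longleftrightarrow> i = j \<and> l = (0, axis j 1)" for i
  proof
    assume eq: "l + (axis j 1, 0) = (axis i 1, axis i 1)"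
    then have f: "fst l $ m + axis j 1 $ m = axis i 1 $ m" and s: "snd l = axis i 1" for m
      by (auto simp: prod_eq_iff vec_eq_iff)
    have "i = j" using f[of j] by (auto simp: axis_def split: if_splits)
    then show "i = j \<and> l = (0, axis j 1)"
      using f s by (auto simp: prod_eq_iff vec_eq_iff)
  qed (auto simp: prod_eq_iff)
  show "deriv_z j (H2 \<omega>) l = (if l = (0, axis j 1) then of_real (\<omega> $ j) else 0)"
    unfolding deriv_z_def H2_def * by (cases "l = (0, axis j 1)") auto
qed

lemma deriv_zbar_H2: "deriv_zbar j (H2 \<omega>) = (\<lambda>l. if l = (axis j 1, 0) then of_real (\<omega> $ j) else 0)"
proof
  fix l :: "'a mindex"
  have *: "l + (0, axis j 1) = (axis i 1, axis i 1) \<longleftrightarrow> i = j \<and> l = (axis j 1, 0)" for i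
  proof
    assume eq: "l + (0, axis j 1) = (axis i 1, axis i 1)"
    then have f: "snd l $ m + axis j 1 $ m = axis i 1 $ m" and s: "fst l = axis i 1" for m
      by (auto simp: prod_eq_iff vec_eq_iff)
    have "i = j" using f[of j] by (auto simp: axis_def split: if_splits)
    then show "i = j \<and> l = (axis j 1, 0)"
      using f s by (auto simp: prod_eq_iff vec_eq_iff)
  qed (auto simp: prod_eq_iff)
  show "deriv_zbar j (H2 \<omega>) l = (if l = (axis j 1, 0) then of_real (\<omega> $ j) else 0)"
    unfolding deriv_zbar_def H2_def * by (cases "l = (axis j 1, 0)") auto
qed

text \<open>The only splitting of \<open>a + e\<close> that can contribute is
  \<open>(a, e)\<close>.\<close>

lemma series_mult_single_right:
  "series_mult F (\<lambda>l. if l = e then c else 0) (a + e) = F a * c"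
proof -
  have "series_mult F (\<lambda>l. if l = e then c else 0) (a + e)
      = (\<Sum>(x, y)\<in>{(a, e)}. F x * (if y = e then c else 0))"
    unfolding series_mult_def
  proof (intro sum.mono_neutral_right finite_mindex_splittings ballI)
    fix i assume i: "i \<in> {(x, y). x + y = a + e} - {(a, e)}"
    obtain x y where "i = (x, y)" by (meson surj_pair)
    with i show "(case i of (x, y) \<Rightarrow> F x * (if y = e then c else 0)) = 0" by (cases "y = e") auto
  qed auto
  then show ?thesis by simp
qed

lemma series_mult_single_right_eq_0:
  assumes "\<And>a. a + e \<noteq> k"
  shows "series_mult F (\<lambda>l. if l = e then c else 0) k = 0"
  unfolding series_mult_def
proof (intro sum.neutral ballI)
  fix i assume i: "i \<in> {(x, y). x + y = k}"
  obtain x y where "i = (x, y)" by (meson surj_pair)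
  with i assms[of x] show "(case i of (x, y) \<Rightarrow> F x * (if y = e then c else 0)) = 0" by (cases "y = e") auto
qed

text \<open>For \<open>c = 1\<close> this is the Euler operator of \<open>zbar\<^sub>j\<close>,
  which is diagonal on monomials.\<close>

lemma series_mult_deriv_zbar_single:
  "series_mult (deriv_zbar j F) (\<lambda>l. if l = (0, axis j 1) then c else 0) k
     = of_nat (snd k $ j) * F k * c"
proof (cases "snd k $ j")
  case 0
  have "a + (0, axis j 1) \<noteq> k" for a using 0 by auto
  with 0 show ?thesis by (simp add: series_mult_single_right_eq_0)
next
  case (Suc m)
  \<comment> \<open>The truncated subtraction is exact because entry \<open>j\<close> is a
    successor.\<close>
  define a where "a = (fst k, \<chi> i. snd k $ i - axis j 1 $ i)"
  have a: "a + (0, axis j 1) = k"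
    using Suc by (auto simp: a_def prod_eq_iff vec_eq_iff axis_def)
  have "of_nat (snd a $ j) + 1 = (of_nat (snd k $ j) :: complex)"
    by (simp add: axis_def flip: a)
  with a series_mult_single_right[of "deriv_zbar j F" "(0, axis j 1)" c a] show ?thesis
    by (simp add: deriv_zbar_def del: One_nat_def)
qed

lemma series_mult_deriv_z_single:
  "series_mult (deriv_z j F) (\<lambda>l. if l = (axis j 1, 0) then c else 0) k
     = of_nat (fst k $ j) * F k * c"
proof (cases "fst k $ j")
  case 0
  have "a + (axis j 1, 0) \<noteq> k" for a using 0 by auto
  with 0 show ?thesis by (simp add: series_mult_single_right_eq_0)
next
  case (Suc m)
  define a where "a = (\<chi> i. fst k $ i - axis j 1 $ i, snd k)"
  have a: "a + (axis j 1, 0) = k"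
    using Suc by (auto simp: a_def prod_eq_iff vec_eq_iff axis_def)
  have "of_nat (fst a $ j) + 1 = (of_nat (fst k $ j) :: complex)"
    by (simp add: axis_def flip: a)
  with a series_mult_single_right[of "deriv_z j F" "(axis j 1, 0)" c a] show ?thesis
    by (simp add: deriv_z_def del: One_nat_def)
qed

text \<open>The bracket with \<open>H2\<close> is \<open>i\<close> times the
  \<open>\<omega>\<close>-weighted difference of the barred and unbarred Euler operators, hence
  diagonal.\<close>

lemma bracket_H2: "bracket F (H2 \<omega>) k = \<i> * of_real (pairing \<omega> (mdiff k)) * F k"
  by (simp add: bracket_def deriv_z_H2 deriv_zbar_H2 series_mult_deriv_z_single
      series_mult_deriv_zbar_single pairing_def mdiff_def sum_distrib_left sum_distrib_right algebra_simps
      del: One_nat_def)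

text \<open>The factor \<open>- i sgn\<close> in \<open>xi\<close> cancels the \<open>i\<close> of
  \<open>bracket_H2\<close> and turns the pairing into its absolute value. This sign makes the
  linear part a damping.\<close>

lemma bracket_xi_H2:
  assumes "H \<in> F_diamond"
  shows "bracket (xi \<omega> H) (H2 \<omega>) k = of_real \<bar>pairing \<omega> (mdiff k)\<bar> * H k"
proof (cases "mdegree k \<ge> 3")
  case True
  have "\<i> * p * (- \<i> * s * h) = p * s * h" for p s h :: complex
  proof -
    have "\<i> * p * (- \<i> * s * h) = (\<i> * - \<i>) * (p * s * h)" by (simp only: mult_ac)
    then show ?thesis by simp
  qed
  with True show ?thesis by (simp only: bracket_H2 xi_def if_True abs_sgn of_real_mult)
next
  case False
  with assms have "H k = 0" unfolding F_diamond_def by simp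
  with False show ?thesis by (simp add: bracket_H2 xi_def)
qed

section \<open>Triangularity of the quadratic part\<close>

definition quad :: "real ^ 'n \<Rightarrow> 'n series \<Rightarrow> 'n::finite series" where
  "quad \<omega> H = bracket (xi \<omega> H) H"

definition decay :: "real ^ 'n \<Rightarrow> 'n::finite mindex \<Rightarrow> real" where
  "decay \<omega> k = \<bar>pairing \<omega> (mdiff k)\<bar>"

lemma decay_nonneg: "0 \<le> decay \<omega> k"
  by (simp add: decay_def)

lemma F_diamondD: "H \<in> F_diamond \<Longrightarrow> mdegree k < 3 \<Longrightarrow> H k = 0"
  unfolding F_diamond_def by simp

lemma F_diamondI: "(\<And>k. mdegree k < 3 \<Longrightarrow> H k = 0) \<Longrightarrow> H \<in> F_diamond"
  unfolding F_diamond_def by simp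

text \<open>This is where starting in degree 3 enters. If \<open>a\<close> and \<open>b\<close> both
  have degree at least 2, then \<open>a + e\<close> and \<open>b + e'\<close> have degree below that
  of \<open>a + b\<close>. Otherwise one factor on each side has degree below 3 and
  vanishes.\<close>

lemma mult_shift_cong:
  fixes F F' G G' :: "'n::finite series"
  assumes "F \<in> F_diamond" "G \<in> F_diamond" "F' \<in> F_diamond" "G' \<in> F_diamond"
    and F: "\<And>l. mdegree l < mdegree (a + b) \<Longrightarrow> F l = F' l"
    and G: "\<And>l. mdegree l < mdegree (a + b) \<Longrightarrow> G l = G' l"
    and e: "mdegree e = 1" "mdegree e' = 1"
  shows "F (a + e) * G (b + e') = F' (a + e) * G' (b + e')"
proof -
  consider "mdegree a + 1 < mdegree (a + b)" "mdegree b + 1 < mdegree (a + b)"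
    | "mdegree b + 1 < 3" | "mdegree a + 1 < 3"
    by (auto simp: mdegree_add) linarith
  then show ?thesis
  proof cases
    case 1
    then show ?thesis using F[of "a + e"] G[of "b + e'"] e by (simp add: mdegree_add)
  next
    case 2
    then have "mdegree (b + e') < 3" using e by (simp add: mdegree_add)
    with assms show ?thesis by (simp add: F_diamondD)
  next
    case 3
    then have "mdegree (a + e) < 3" using e by (simp add: mdegree_add)
    with assms show ?thesis by (simp add: F_diamondD)
  qed
qed

lemma bracket_cong:
  fixes F F' G G' :: "'n::finite series"
  assumes "F \<in> F_diamond" "G \<in> F_diamond" "F' \<in> F_diamond" "G' \<in> F_diamond"
    and "\<And>l. mdegree l < mdegree k \<Longrightarrow> F l = F' l"
    and "\<And>l. mdegree l < mdegree k \<Longrightarrow> G l = G' l"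
  shows "bracket F G k = bracket F' G' k"
proof -
  have *: "F (a + e) * G (b + e') = F' (a + e) * G' (b + e')"
    if "a + b = k" "mdegree e = 1" "mdegree e' = 1" for a b e e'
    using mult_shift_cong[of F G F' G' a b e e'] assms that by simp
  \<comment> \<open>The weights \<open>u\<close>, \<open>v\<close> are arbitrary so that one claim
    serves both products in the bracket.\<close>
  have **: "series_mult (\<lambda>a. of_nat (u a) * F (a + e)) (\<lambda>b. of_nat (v b) * G (b + e')) k
          = series_mult (\<lambda>a. of_nat (u a) * F' (a + e)) (\<lambda>b. of_nat (v b) * G' (b + e')) k"
    if "mdegree e = 1" "mdegree e' = 1" for u v e e'
    unfolding series_mult_def
  proof (rule sum.cong[OF refl], safe)
    fix a b :: "'n mindex" assume "k = a + b"
    then show "of_nat (u a) * F (a + e) * (of_nat (v b) * G (b + e'))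
             = of_nat (u a) * F' (a + e) * (of_nat (v b) * G' (b + e'))"
      using *[of a b e e'] that by (simp add: mult.assoc mult.left_commute)
  qed
  show ?thesis
    unfolding bracket_def deriv_z_def deriv_zbar_def
    by (intro arg_cong[where f = "\<lambda>x. \<i> * x"] sum.cong refl arg_cong2[where f = "(-)"] **) simp_all
qed

lemma xi_in_F_diamond: "xi \<omega> H \<in> F_diamond"
  by (rule F_diamondI) (simp add: xi_def)

lemma quad_cong:
  assumes "H \<in> F_diamond" "H' \<in> F_diamond"
    and "\<And>l. mdegree l < mdegree k \<Longrightarrow> H l = H' l"
  shows "quad \<omega> H k = quad \<omega> H' k"
  unfolding quad_def
  by (rule bracket_cong) (use assms in \<open>simp_all add: xi_in_F_diamond, simp add: xi_def\<close>)

text \<open>By triangularity \<open>quad\<close> can be compared with its value at the zero series,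
  since all coefficients below degree 3 vanish.\<close>

lemma quad_eq_0:
  assumes "H \<in> F_diamond" "mdegree k \<le> 3"
  shows "quad \<omega> H k = 0"
proof -
  have "quad \<omega> H k = quad \<omega> (\<lambda>_. 0) k"
  proof (rule quad_cong[OF assms(1)])
    show "H l = 0" if "mdegree l < mdegree k" for l
      using that assms by (simp add: F_diamondD)
  qed (simp add: F_diamond_def)
  also have "\<dots> = 0"
    by (simp add: quad_def bracket_def series_mult_def deriv_z_def deriv_zbar_def case_prod_beta)
  finally show ?thesis .
qed

text \<open>Each coefficient of \<open>quad\<close> is a polynomial in finitely many coefficients of
  \<open>H\<close>.\<close>

lemma continuous_on_quad:
  assumes "\<And>k. continuous_on S (\<lambda>s. H s k)"
  shows "continuous_on S (\<lambda>s. quad \<omega> (H s) k)"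
proof -
  have "continuous_on S (\<lambda>s. xi \<omega> (H s) k)" for k
    unfolding xi_def by (cases "mdegree k \<ge> 3") (auto intro!: continuous_intros assms)
  then show ?thesis
    unfolding quad_def bracket_def series_mult_def deriv_z_def deriv_zbar_def case_prod_beta
    by (intro continuous_intros assms)
qed

section \<open>Duhamel's formula\<close>

text \<open>Variation of constants as an operator on curves. The exponential in \<open>t\<close>
  stays outside, so the integrand does not depend on \<open>t\<close>. For \<open>t < 0\<close> the
  integral runs over the empty set and is 0.\<close>

definition duhamel :: "real ^ 'n \<Rightarrow> 'n series \<Rightarrow> (real \<Rightarrow> 'n series) \<Rightarrow> real \<Rightarrow> 'n::finite series" where
  "duhamel \<omega> H0 H t k = exp (- (decay \<omega> k * t)) *\<^sub>R
     (H0 k - integral {0..t} (\<lambda>s. exp (decay \<omega> k * s) *\<^sub>R quad \<omega> (H s) k))"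

lemma flow_solution_iff:
  "flow_solution \<omega> H0 H \<longleftrightarrow> H 0 = H0 \<and> (\<forall>t\<ge>0. H t \<in> F_diamond) \<and>
     (\<forall>t\<ge>0. \<forall>k. ((\<lambda>s. H s k) has_vector_derivative
        - (decay \<omega> k *\<^sub>R H t k) - quad \<omega> (H t) k) (at t within {0..}))"
proof -
  have "- bracket (xi \<omega> F) (\<lambda>l. H2 \<omega> l + F l) k = - (decay \<omega> k *\<^sub>R F k) - quad \<omega> F k"
    if "F \<in> F_diamond" for F k
    using that by (simp add: bracket_add bracket_xi_H2 quad_def decay_def scaleR_conv_of_real)
  then show ?thesis unfolding flow_solution_def by (intro conj_cong refl all_cong) simp
qed

lemma flow_solution_continuous:
  assumes "flow_solution \<omega> H0 H"
  shows "continuous_on {0..} (\<lambda>s. H s k)"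
  using assms unfolding flow_solution_def continuous_on_eq_continuous_within
  by (meson atLeast_iff has_vector_derivative_continuous)

text \<open>With the integrating factor \<open>exp (decay \<omega> k * s)\<close> the linear term
  cancels, and only \<open>quad\<close> remains to be integrated.\<close>

lemma flow_solution_duhamel:
  assumes H: "flow_solution \<omega> H0 H" and "t \<ge> 0"
  shows "H t = duhamel \<omega> H0 H t"
proof
  fix k
  let ?d = "decay \<omega> k"
  let ?u = "\<lambda>s. exp (?d * s) *\<^sub>R H s k"
  have "((\<lambda>s. - (exp (?d * s) *\<^sub>R quad \<omega> (H s) k)) has_integral ?u t - ?u 0) {0..t}"
  proof (rule fundamental_theorem_of_calculus[OF \<open>t \<ge> 0\<close>])
    fix s assume s: "s \<in> {0..t}"
    have "((\<lambda>s. H s k) has_vector_derivative - (?d *\<^sub>R H s k) - quad \<omega> (H s) k) (at s within {0..t})"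
      using H s unfolding flow_solution_iff
      by (auto intro: has_vector_derivative_within_subset[of _ _ s "{0..}" "{0..t}"])
    then have "(?u has_vector_derivative
        exp (?d * s) *\<^sub>R (- (?d *\<^sub>R H s k) - quad \<omega> (H s) k) + (?d * exp (?d * s)) *\<^sub>R H s k)
        (at s within {0..t})"
      by (intro has_vector_derivative_scaleR) (auto intro!: derivative_eq_intros)
    then show "(?u has_vector_derivative - (exp (?d * s) *\<^sub>R quad \<omega> (H s) k)) (at s within {0..t})"
      by (simp add: algebra_simps)
  qed
  from has_integral_neg[OF this]
  have "((\<lambda>s. exp (?d * s) *\<^sub>R quad \<omega> (H s) k) has_integral H 0 k - ?u t) {0..t}" by simp
  from integral_unique[OF this] have "integral {0..t} (\<lambda>s. exp (?d * s) *\<^sub>R quad \<omega> (H s) k) = H 0 k - ?u t" .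
  then show "H t k = duhamel \<omega> H0 H t k"
    using H by (simp add: duhamel_def flow_solution_def exp_minus)
qed

lemma integral_has_vector_derivative_atLeast:
  fixes f :: "real \<Rightarrow> complex"
  assumes "continuous_on {0..} f" "t \<ge> 0"
  shows "((\<lambda>s. integral {0..s} f) has_vector_derivative f t) (at t within {0..})"
proof -
  \<comment> \<open>The right end lies beyond \<open>t\<close>, so the filter at \<open>t\<close>
    agrees with that of \<open>{0..}\<close>.\<close>
  have "((\<lambda>s. integral {0..s} f) has_vector_derivative f t) (at t within {0..t + 1})"
    using assms by (intro integral_has_vector_derivative) (auto intro: continuous_on_subset)
  moreover have "at t within {0..t + 1} = at t within {0..}"
    by (rule at_within_nhd[of t "{..<t + 1}"]) auto
  ultimately show ?thesis by simp
qed

text \<open>The curve \<open>H\<close> is frozen in the quadratic term: \<open>duhamel\<close>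
  solves the resulting linear equation, so a fixed point satisfies the flow equation.\<close>

lemma duhamel_has_vector_derivative:
  assumes "\<And>k. continuous_on {0..} (\<lambda>s. H s k)" "t \<ge> 0"
  shows "((\<lambda>s. duhamel \<omega> H0 H s k) has_vector_derivative
     - (decay \<omega> k *\<^sub>R duhamel \<omega> H0 H t k) - quad \<omega> (H t) k) (at t within {0..})"
proof -
  let ?d = "decay \<omega> k"
  let ?f = "\<lambda>s. exp (?d * s) *\<^sub>R quad \<omega> (H s) k"
  have "continuous_on {0..} ?f"
    by (intro continuous_intros continuous_on_quad assms)
  then have "((\<lambda>s. H0 k - integral {0..s} ?f) has_vector_derivative 0 - ?f t) (at t within {0..})"
    using \<open>t \<ge> 0\<close>
    by (intro has_vector_derivative_diff has_vector_derivative_const integral_has_vector_derivative_atLeast)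
  then have "((\<lambda>s. exp (- (?d * s)) *\<^sub>R (H0 k - integral {0..s} ?f)) has_vector_derivative
      exp (- (?d * t)) *\<^sub>R (0 - ?f t) + (- ?d * exp (- (?d * t))) *\<^sub>R (H0 k - integral {0..t} ?f))
      (at t within {0..})"
    by (intro has_vector_derivative_scaleR) (auto intro!: derivative_eq_intros)
  then show ?thesis
    by (simp add: duhamel_def exp_minus algebra_simps)
qed

lemma duhamel_continuous:
  assumes "\<And>k. continuous_on {0..} (\<lambda>s. H s k)"
  shows "continuous_on {0..} (\<lambda>s. duhamel \<omega> H0 H s k)"
  unfolding continuous_on_eq_continuous_within
  using duhamel_has_vector_derivative[of H] assms by (meson atLeast_iff has_vector_derivative_continuous)

lemma duhamel_in_F_diamond:
  assumes "H0 \<in> F_diamond" "\<And>s. H s \<in> F_diamond"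
  shows "duhamel \<omega> H0 H t \<in> F_diamond"
  using assms by (intro F_diamondI) (simp add: duhamel_def F_diamondD quad_eq_0)

lemma duhamel_cong:
  assumes "\<And>s. s \<ge> 0 \<Longrightarrow> H s \<in> F_diamond" "\<And>s. s \<ge> 0 \<Longrightarrow> H' s \<in> F_diamond"
    and "\<And>s l. s \<ge> 0 \<Longrightarrow> mdegree l < mdegree k \<Longrightarrow> H s l = H' s l"
  shows "duhamel \<omega> H0 H t k = duhamel \<omega> H0 H' t k"
proof -
  have "integral {0..t} (\<lambda>s. exp (decay \<omega> k * s) *\<^sub>R quad \<omega> (H s) k)
      = integral {0..t} (\<lambda>s. exp (decay \<omega> k * s) *\<^sub>R quad \<omega> (H' s) k)"
    using assms by (intro integral_cong arg_cong2[where f = scaleR] refl quad_cong) auto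
  then show ?thesis by (simp add: duhamel_def)
qed

section \<open>Existence and uniqueness of the flow\<close>

text \<open>Both solutions are fixed points of \<open>duhamel\<close>, which computes a coefficient
  from those of lower degree only; induction on the degree concludes.\<close>

lemma flow_solution_unique:
  assumes H: "flow_solution \<omega> H0 H" and H': "flow_solution \<omega> H0 H'" and t: "t \<ge> 0"
  shows "H t = H' t"
proof
  fix k
  show "H t k = H' t k"
    using t
  proof (induction "mdegree k" arbitrary: k t rule: less_induct)
    case less
    have "duhamel \<omega> H0 H t k = duhamel \<omega> H0 H' t k"
      using H H' less(1) by (intro duhamel_cong) (auto simp: flow_solution_def)
    then show ?case
      using flow_solution_duhamel[OF H less(2)] flow_solution_duhamel[OF H' less(2)] by metis
  qed
qed

primrec picard :: "real ^ 'n \<Rightarrow> 'n series \<Rightarrow> nat \<Rightarrow> real \<Rightarrow> 'n::finite series" where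
  "picard \<omega> H0 0 = (\<lambda>t k. 0)"
| "picard \<omega> H0 (Suc m) = duhamel \<omega> H0 (picard \<omega> H0 m)"

lemma picard_in_F_diamond: "H0 \<in> F_diamond \<Longrightarrow> picard \<omega> H0 m t \<in> F_diamond"
  by (induction m arbitrary: t) (simp_all add: F_diamondI duhamel_in_F_diamond)

lemma picard_continuous: "continuous_on {0..} (\<lambda>s. picard \<omega> H0 m s k)"
  by (induction m arbitrary: k) (simp_all add: duhamel_continuous)

text \<open>Each application of \<open>duhamel\<close> settles one further degree, so every
  coefficient becomes stationary after finitely many iterates and no limit is taken.\<close>

lemma picard_Suc_eq:
  assumes "H0 \<in> F_diamond" "mdegree k < m"
  shows "picard \<omega> H0 (Suc m) t k = picard \<omega> H0 m t k"
  using assms(2)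
proof (induction m arbitrary: k t)
  case (Suc m)
  have "duhamel \<omega> H0 (picard \<omega> H0 (Suc m)) t k = duhamel \<omega> H0 (picard \<omega> H0 m) t k"
    by (rule duhamel_cong) (use Suc assms(1) in \<open>auto intro: picard_in_F_diamond simp del: picard.simps\<close>)
  then show ?case by simp
qed simp

lemma picard_eq:
  assumes "H0 \<in> F_diamond" "mdegree k < m" "m \<le> m'"
  shows "picard \<omega> H0 m' t k = picard \<omega> H0 m t k"
  using assms(3)
proof (induction m' rule: dec_induct)
  case (step i)
  then show ?case using picard_Suc_eq[OF assms(1), of k i \<omega> t] assms(2) by simp
qed simp

lemma flow_solution_exists:
  fixes H0 :: "'n::finite series"
  assumes H0: "H0 \<in> F_diamond"
  shows "\<exists>H. flow_solution \<omega> H0 H"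
proof -
  \<comment> \<open>Diagonal choice: each coefficient is read off from an iterate at which it is
    already stationary.\<close>
  define H where "H t k = picard \<omega> H0 (Suc (mdegree k)) t k" for t k
  have FH: "H t \<in> F_diamond" for t
    using H0 by (intro F_diamondI) (simp add: H_def F_diamondD picard_in_F_diamond del: picard.simps)
  have cont: "continuous_on {0..} (\<lambda>s. H s k)" for k
    unfolding H_def by (rule picard_continuous)
  \<comment> \<open>Unfolding one Picard step leaves iterate \<open>mdegree k\<close>, which agrees
    with \<open>H\<close> in the degrees below \<open>mdegree k\<close>, the only ones that
    matter.\<close>
  have fixed_point: "H t k = duhamel \<omega> H0 H t k" for t k
    unfolding H_def[of t k] picard.simps
  proof (rule duhamel_cong)
    fix s and l :: "'n mindex" assume "mdegree l < mdegree k"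
    then show "picard \<omega> H0 (mdegree k) s l = H s l"
      unfolding H_def by (intro picard_eq H0) auto
  qed (use FH H0 in \<open>auto intro: picard_in_F_diamond\<close>)
  have "((\<lambda>s. H s k) has_vector_derivative - (decay \<omega> k *\<^sub>R H t k) - quad \<omega> (H t) k) (at t within {0..})"
    if "t \<ge> 0" for t k
    using duhamel_has_vector_derivative[of H t \<omega> H0 k, OF cont that] by (simp flip: fixed_point)
  moreover have "H 0 = H0"
    by (rule ext) (subst fixed_point, simp add: duhamel_def)
  ultimately show ?thesis
    using FH unfolding flow_solution_iff by blast
qed

lemma phi_eq:
  assumes "flow_solution \<omega> H0 H" "t \<ge> 0"
  shows "phi \<omega> t H0 = H t"
  unfolding phi_def using assms flow_solution_unique by (intro the_equality) blast+

section \<open>Majorant estimates along the flow\<close>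

text \<open>The damping is dropped here: \<open>decay\<close> is nonnegative, so
  \<open>exp (decay \<omega> k * (s - t)) \<le> 1\<close> for \<open>s \<le> t\<close>.\<close>

lemma degnorm_duhamel_le:
  assumes cont: "\<And>k. continuous_on {0..} (\<lambda>s. H s k)" and t: "t \<ge> 0"
  shows "degnorm (duhamel \<omega> H0 H t) m \<le> degnorm H0 m + integral {0..t} (\<lambda>s. degnorm (quad \<omega> (H s)) m)"
proof -
  have cq: "continuous_on {0..t} (\<lambda>s. quad \<omega> (H s) k)" for k
    by (rule continuous_on_subset[OF continuous_on_quad[OF cont]]) auto
  have *: "cmod (duhamel \<omega> H0 H t k) \<le> cmod (H0 k) + integral {0..t} (\<lambda>s. cmod (quad \<omega> (H s) k))" for k
  proof -
    let ?d = "decay \<omega> k"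
    let ?f = "\<lambda>s. exp (?d * s) *\<^sub>R quad \<omega> (H s) k"
    have "cmod (integral {0..t} ?f) \<le> integral {0..t} (\<lambda>s. exp (?d * t) * cmod (quad \<omega> (H s) k))"
    proof (rule integral_norm_bound_integral)
      show "?f integrable_on {0..t}" "(\<lambda>s. exp (?d * t) * cmod (quad \<omega> (H s) k)) integrable_on {0..t}"
        by (intro integrable_continuous_interval continuous_intros cq)+
      show "cmod (?f s) \<le> exp (?d * t) * cmod (quad \<omega> (H s) k)" if "s \<in> {0..t}" for s
        using that decay_nonneg[of \<omega> k] by (auto intro!: mult_right_mono mult_left_mono)
    qed
    also have "\<dots> = exp (?d * t) * integral {0..t} (\<lambda>s. cmod (quad \<omega> (H s) k))"
      by simp
    finally have I: "exp (- (?d * t)) * cmod (integral {0..t} ?f) \<le> integral {0..t} (\<lambda>s. cmod (quad \<omega> (H s) k))"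
      by (simp add: exp_minus field_simps)
    have "cmod (duhamel \<omega> H0 H t k) \<le> exp (- (?d * t)) * (cmod (H0 k) + cmod (integral {0..t} ?f))"
      unfolding duhamel_def by (simp add: norm_triangle_ineq4)
    also have "\<dots> \<le> 1 * cmod (H0 k) + integral {0..t} (\<lambda>s. cmod (quad \<omega> (H s) k))"
      unfolding distrib_left using decay_nonneg[of \<omega> k] t I by (intro add_mono mult_right_mono) auto
    finally show ?thesis by simp
  qed
  have "degnorm (duhamel \<omega> H0 H t) m
      \<le> (\<Sum>k | mdegree k = m. cmod (H0 k) + integral {0..t} (\<lambda>s. cmod (quad \<omega> (H s) k)))"
    unfolding degnorm_def by (intro sum_mono *)
  also have "\<dots> = degnorm H0 m + integral {0..t} (\<lambda>s. degnorm (quad \<omega> (H s)) m)"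
    unfolding degnorm_def sum.distrib
    by (subst integral_sum) (auto intro!: integrable_continuous_interval continuous_intros cq)
  finally show ?thesis .
qed

text \<open>Telescoping by \<open>1 / (n + 1)\<^sup>2 \<le> 1 / n - 1 / (n + 1)\<close>; the
  stronger bound with the subtracted term carries the induction.\<close>

lemma sum_inverse_squares_le: "(\<Sum>r = 1..<l. 1 / real r ^ 2) \<le> 2"
proof -
  have "(\<Sum>r = 1..<Suc (Suc n). 1 / real r ^ 2) \<le> 2 - 1 / real (Suc n)" for n
  proof (induction n)
    case (Suc n)
    have "1 / real (Suc (Suc n)) ^ 2 \<le> 1 / (real (Suc n) * real (Suc (Suc n)))"
      unfolding power2_eq_square by (intro frac_le mult_right_mono) auto
    also have "\<dots> = 1 / real (Suc n) - 1 / real (Suc (Suc n))"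
      by (simp add: field_simps)
    finally show ?case using Suc by simp
  qed simp
  from order.trans[OF this, of "l - 2" 2] show ?thesis
    by (cases "l < 2") (simp_all add: Suc_diff_Suc numeral_2_eq_2 del: sum.op_ivl_Suc)
qed

text \<open>
  The weight \<open>1 / r\<^sup>3\<close> in the majorant is chosen so that, after multiplication by the factors
  \<open>p, q\<close> coming from the derivatives, the convolution reproduces \<open>1 / l\<^sup>2\<close>.
\<close>

lemma sum_inverse_squares_convolution_le:
  "(\<Sum>r = 1..<l. 1 / (real r ^ 2 * real (l - r) ^ 2)) \<le> 8 / real l ^ 2"
proof -
  have "1 / (real r ^ 2 * real (l - r) ^ 2) \<le> 2 / real l ^ 2 * (1 / real r ^ 2 + 1 / real (l - r) ^ 2)"
    if "r \<in> {1..<l}" for r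
  proof -
    define x y where "x = 1 / real r" and "y = 1 / real (l - r)"
    have pos: "0 < real r" "0 < real (l - r)" using that by auto
    have l: "real l = real r + real (l - r)" using that by auto
    \<comment> \<open>Partial fractions; squaring and
      \<open>(x + y)\<^sup>2 \<le> 2 (x\<^sup>2 + y\<^sup>2)\<close> then separate the two
      terms.\<close>
    have "x * y = (x + y) / real l"
      unfolding l x_def y_def using pos by (simp add: field_simps)
    moreover have "1 / (real r ^ 2 * real (l - r) ^ 2) = (x * y) ^ 2"
      by (simp add: x_def y_def power_divide power_mult_distrib)
    ultimately have "1 / (real r ^ 2 * real (l - r) ^ 2) = (x + y) ^ 2 / real l ^ 2"
      by (simp only: power_divide)
    also have "\<dots> \<le> 2 * (x ^ 2 + y ^ 2) / real l ^ 2"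
      using sum_squares_bound[of x y] by (intro divide_right_mono) (auto simp: power2_sum)
    finally show ?thesis by (simp add: x_def y_def power_divide)
  qed
  then have "(\<Sum>r = 1..<l. 1 / (real r ^ 2 * real (l - r) ^ 2))
      \<le> (\<Sum>r = 1..<l. 2 / real l ^ 2 * (1 / real r ^ 2 + 1 / real (l - r) ^ 2))"
    by (rule sum_mono)
  also have "\<dots> = 2 / real l ^ 2 * ((\<Sum>r = 1..<l. 1 / real r ^ 2) + (\<Sum>r = 1..<l. 1 / real (l - r) ^ 2))"
    by (simp only: sum.distrib sum_distrib_left[symmetric])
  also have "(\<Sum>r = 1..<l. 1 / real (l - r) ^ 2) = (\<Sum>r = 1..<l. 1 / real r ^ 2)"
    by (rule sum.reindex_bij_witness[of _ "\<lambda>r. l - r" "\<lambda>r. l - r"]) auto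
  also have "2 / real l ^ 2 * ((\<Sum>r = 1..<l. 1 / real r ^ 2) + (\<Sum>r = 1..<l. 1 / real r ^ 2))
      \<le> 2 / real l ^ 2 * (2 + 2)"
    by (intro mult_left_mono add_mono sum_inverse_squares_le) auto
  finally show ?thesis by simp
qed

lemma degnorm_eq_0: "H \<in> F_diamond \<Longrightarrow> m < 3 \<Longrightarrow> degnorm H m = 0"
  unfolding degnorm_def by (auto intro!: sum.neutral F_diamondD)

text \<open>Degrees are written as \<open>r + 2\<close>: the bracket lowers the total degree by 2,
  so the shifted indices add up, \<open>r + (l - r) = l\<close>.\<close>

lemma degnorm_quad_le:
  fixes H :: "'n::finite series"
  assumes "H \<in> F_diamond"
  shows "degnorm (quad \<omega> H) (l + 2) \<le> 2 * real CARD('n) *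
    (\<Sum>r = 1..<l. (real (r + 2) * degnorm H (r + 2)) * (real (l - r + 2) * degnorm H (l - r + 2)))"
proof -
  let ?f = "\<lambda>p. (real (Suc p) * degnorm H (Suc p)) * (real (Suc (l + 2 - p)) * degnorm H (Suc (l + 2 - p)))"
  have "degnorm (quad \<omega> H) (l + 2) \<le> 2 * real CARD('n) * (\<Sum>p\<le>l + 2.
      (real (Suc p) * degnorm (xi \<omega> H) (Suc p)) * (real (Suc (l + 2 - p)) * degnorm H (Suc (l + 2 - p))))"
    unfolding quad_def by (rule degnorm_bracket_le)
  also have "\<dots> \<le> 2 * real CARD('n) * (\<Sum>p\<le>l + 2. ?f p)"
    by (intro mult_left_mono sum_mono mult_right_mono degnorm_xi_le) (auto simp: degnorm_nonneg)
  \<comment> \<open>Outside this range one factor has degree below 3 and vanishes. The bounds are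
    written with \<open>Suc\<close> for the index shift that follows.\<close>
  also have "(\<Sum>p\<le>l + 2. ?f p) = (\<Sum>p = Suc 1..<Suc l. ?f p)"
  proof (rule sum.mono_neutral_right)
    show "\<forall>p\<in>{..l + 2} - {Suc 1..<Suc l}. ?f p = 0"
    proof
      fix p assume "p \<in> {..l + 2} - {Suc 1..<Suc l}"
      then have "Suc p < 3 \<or> Suc (l + 2 - p) < 3" by auto
      then show "?f p = 0" using degnorm_eq_0[OF assms] by auto
    qed
  qed auto
  also have "\<dots> = (\<Sum>r = 1..<l. ?f (Suc r))" by (rule sum.shift_bounds_Suc_ivl)
  also have "\<dots> = (\<Sum>r = 1..<l. (real (r + 2) * degnorm H (r + 2)) * (real (l - r + 2) * degnorm H (l - r + 2)))"
  proof (rule sum.cong[OF refl])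
    fix r assume "r \<in> {1..<l}"
    then have "Suc (l + 2 - Suc r) = l - r + 2" "Suc (Suc r) = r + 2" by auto
    then show "?f (Suc r) = (real (r + 2) * degnorm H (r + 2)) * (real (l - r + 2) * degnorm H (l - r + 2))"
      by (simp only:)
  qed
  finally show ?thesis .
qed

text \<open>Here \<open>E\<close> stands for \<open>1 + B t\<close>. With
  \<open>B = 288 n c\<close>, the right-hand side is the time derivative of the majorant
  \<open>c R\<^sup>l E\<^sup>l\<^sup>-\<^sup>1 / l\<^sup>3\<close>.\<close>

lemma degnorm_quad_le_majorant:
  fixes H :: "'n::finite series"
  assumes H: "H \<in> F_diamond" and pos: "c \<ge> 0" "R \<ge> 0" "E \<ge> 0"
    and bound: "\<And>r. 0 < r \<Longrightarrow> r < l \<Longrightarrow> degnorm H (r + 2) \<le> c * R ^ r * E ^ (r - 1) / real r ^ 3"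
  shows "degnorm (quad \<omega> H) (l + 2)
     \<le> c * R ^ l * (real (l - 1) * (288 * real CARD('n) * c) * E ^ (l - 2)) / real l ^ 3"
\<comment> \<open>For \<open>l < 2\<close> the degree is at most 3, where \<open>quad\<close>
  vanishes; on the right \<open>l - 1 = 0\<close>.\<close>
proof (cases "l < 2")
  case True
  then have "degnorm (quad \<omega> H) (l + 2) = 0"
    unfolding degnorm_def by (auto intro!: sum.neutral quad_eq_0 H)
  with True show ?thesis by (cases l) auto
next
  case False
  let ?n = "real CARD('n)"
  have b: "real (r + 2) * degnorm H (r + 2) \<le> 3 * (c * R ^ r * E ^ (r - 1)) / real r ^ 2"
    if "0 < r" "r < l" for r
  proof -
    \<comment> \<open>Since \<open>r \<ge> 1\<close>, \<open>r + 2 \<le> 3 r\<close>; the derivative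
      weight lowers \<open>r\<^sup>3\<close> to \<open>r\<^sup>2\<close>.\<close>
    have "real (r + 2) * degnorm H (r + 2) \<le> (3 * real r) * (c * R ^ r * E ^ (r - 1) / real r ^ 3)"
      using that pos by (intro mult_mono bound) (auto simp: degnorm_nonneg)
    also have "\<dots> = 3 * (c * R ^ r * E ^ (r - 1)) / real r ^ 2"
      using that by (simp add: power2_eq_square power3_eq_cube)
    finally show ?thesis .
  qed
  have "(\<Sum>r = 1..<l. (real (r + 2) * degnorm H (r + 2)) * (real (l - r + 2) * degnorm H (l - r + 2)))
      \<le> (\<Sum>r = 1..<l. 9 * c ^ 2 * R ^ l * E ^ (l - 2) * (1 / (real r ^ 2 * real (l - r) ^ 2)))"
  proof (rule sum_mono)
    fix r assume r: "r \<in> {1..<l}"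
    have "(real (r + 2) * degnorm H (r + 2)) * (real (l - r + 2) * degnorm H (l - r + 2))
      \<le> (3 * (c * R ^ r * E ^ (r - 1)) / real r ^ 2) * (3 * (c * R ^ (l - r) * E ^ (l - r - 1)) / real (l - r) ^ 2)"
      using r pos by (intro mult_mono b) (auto simp: degnorm_nonneg)
    also have "\<dots> = 9 * c ^ 2 * (R ^ r * R ^ (l - r)) * (E ^ (r - 1) * E ^ (l - r - 1))
        * (1 / (real r ^ 2 * real (l - r) ^ 2))"
      by (simp add: power2_eq_square)
    also have "R ^ r * R ^ (l - r) = R ^ l" using r by (simp flip: power_add)
    also have "E ^ (r - 1) * E ^ (l - r - 1) = E ^ (l - 2)"
    proof -
      have "r - 1 + (l - r - 1) = l - 2" using r by auto
      then show ?thesis by (simp only: flip: power_add)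
    qed
    finally show "(real (r + 2) * degnorm H (r + 2)) * (real (l - r + 2) * degnorm H (l - r + 2))
      \<le> 9 * c ^ 2 * R ^ l * E ^ (l - 2) * (1 / (real r ^ 2 * real (l - r) ^ 2))" .
  qed
  also have "\<dots> \<le> 9 * c ^ 2 * R ^ l * E ^ (l - 2) * (8 / real l ^ 2)"
    unfolding sum_distrib_left[symmetric]
    using pos by (intro mult_left_mono sum_inverse_squares_convolution_le) auto
  finally have "degnorm (quad \<omega> H) (l + 2) \<le> 2 * ?n * (9 * c ^ 2 * R ^ l * E ^ (l - 2) * (8 / real l ^ 2))"
    by (intro order.trans[OF degnorm_quad_le[OF H]] mult_left_mono) auto
  \<comment> \<open>The constant so far is \<open>2 * 9 * 8 = 144\<close>. A further
    \<open>l\<close> in the denominator costs a factor \<open>l = 2 (l / 2)\<close>, and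
    \<open>l / 2 \<le> l - 1\<close> because \<open>l \<ge> 2\<close>.\<close>
  also have "\<dots> = (288 * ?n * c ^ 2 * R ^ l * E ^ (l - 2) / real l ^ 3) * (real l / 2)"
    using False by (simp add: power2_eq_square power3_eq_cube)
  also have "\<dots> \<le> (288 * ?n * c ^ 2 * R ^ l * E ^ (l - 2) / real l ^ 3) * real (l - 1)"
    using False pos by (intro mult_left_mono) auto
  finally show ?thesis by (simp add: power2_eq_square mult_ac)
qed

text \<open>By induction the integrand is at most the derivative \<open>?M'\<close> of the majorant
  \<open>?M\<close>, and \<open>init\<close> is the bound at time 0. At \<open>r = 0\<close>
  division by zero makes both \<open>init\<close> and the conclusion say that the part of degree 2
  vanishes.\<close>

lemma degnorm_flow_le:
  fixes H0 :: "'n::finite series"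
  assumes H: "flow_solution \<omega> H0 H" and pos: "c \<ge> 0" "R \<ge> 0" and B: "B = 288 * real CARD('n) * c"
    and init: "\<And>r. degnorm H0 (r + 2) \<le> c * R ^ r / real r ^ 3"
    and t: "t \<ge> 0"
  shows "degnorm (H t) (r + 2) \<le> c * R ^ r * (1 + B * t) ^ (r - 1) / real r ^ 3"
  using t
proof (induction r arbitrary: t rule: less_induct)
  case (less r)
  have F: "H s \<in> F_diamond" if "s \<ge> 0" for s using H that by (simp add: flow_solution_def)
  have B0: "B \<ge> 0" using B pos by simp
  let ?M = "\<lambda>s. c * R ^ r * (1 + B * s) ^ (r - 1) / real r ^ 3"
  let ?M' = "\<lambda>s. c * R ^ r * (real (r - 1) * B * (1 + B * s) ^ (r - 2)) / real r ^ 3"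
  have M': "(?M' has_integral ?M t - ?M 0) {0..t}"
  proof (rule fundamental_theorem_of_calculus[OF less.prems])
    fix s
    define C where "C = c * R ^ r / real r ^ 3"
    have "((\<lambda>s. C * (1 + B * s) ^ (r - 1)) has_real_derivative
        C * (real (r - 1) * B * (1 + B * s) ^ (r - 2))) (at s within {0..t})"
      by (auto intro!: derivative_eq_intros simp: numeral_2_eq_2)
    then have "(?M has_real_derivative ?M' s) (at s within {0..t})"
      by (simp add: C_def)
    then show "(?M has_vector_derivative ?M' s) (at s within {0..t})"
      by (simp add: has_real_derivative_iff_has_vector_derivative)
  qed
  have cont: "continuous_on {0..t} (\<lambda>s. quad \<omega> (H s) k)" for k
    by (rule continuous_on_subset[OF continuous_on_quad[OF flow_solution_continuous[OF H]]]) auto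
  have "degnorm (H t) (r + 2) = degnorm (duhamel \<omega> H0 H t) (r + 2)"
    using flow_solution_duhamel[OF H less.prems] by simp
  also have "\<dots> \<le> degnorm H0 (r + 2) + integral {0..t} (\<lambda>s. degnorm (quad \<omega> (H s)) (r + 2))"
    by (rule degnorm_duhamel_le[OF flow_solution_continuous[OF H] less.prems])
  also have "\<dots> \<le> ?M 0 + integral {0..t} ?M'"
  proof (intro add_mono integral_le)
    show "degnorm H0 (r + 2) \<le> ?M 0" using init[of r] by simp
    show "(\<lambda>s. degnorm (quad \<omega> (H s)) (r + 2)) integrable_on {0..t}"
      unfolding degnorm_def by (intro integrable_continuous_interval continuous_intros cont)
    show "?M' integrable_on {0..t}" using M' by blast
    fix s assume "s \<in> {0..t}"
    then show "degnorm (quad \<omega> (H s)) (r + 2) \<le> ?M' s"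
      unfolding B using B0 pos less.IH by (intro degnorm_quad_le_majorant F) (auto simp: B)
  qed
  also have "\<dots> = ?M t" using integral_unique[OF M'] by simp
  finally show ?case .
qed

section \<open>Degree norms and convergence in polydiscs\<close>

lemma norm_monomial_le:
  assumes "z \<in> polydisc g"
  shows "cmod (monomial z k) \<le> g ^ mdegree k"
proof -
  have "cmod (monomial z k) = (\<Prod>j\<in>UNIV. cmod (fst z $ j) ^ (fst k $ j) * cmod (snd z $ j) ^ (snd k $ j))"
    by (simp add: monomial_def norm_mult norm_power flip: prod_norm)
  also have "\<dots> \<le> (\<Prod>j\<in>UNIV. g ^ (fst k $ j) * g ^ (snd k $ j))"
    using assms unfolding polydisc_def
    by (intro prod_mono conjI mult_mono power_mono mult_nonneg_nonneg zero_le_power)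
       (auto intro: less_imp_le order.trans[OF norm_ge_zero])
  also have "\<dots> = g ^ mdegree k"
    by (simp add: mdegree_def power_sum power_add)
  finally show ?thesis .
qed

text \<open>Absolute convergence at the single point with all coordinates \<open>\<rho> / 2\<close>
  takes the place of Cauchy's estimates: its sum \<open>S\<close> bounds every homogeneous part
  there.\<close>

lemma A_space_imp_degnorm_le:
  fixes H :: "'n::finite series"
  assumes "H \<in> A_space \<rho>" "\<rho> > 0"
  shows "\<exists>S\<ge>0. \<forall>m. degnorm H m \<le> S * (2 / \<rho>) ^ m"
proof -
  define z :: "'n point" where "z = (\<chi> j. of_real (\<rho> / 2), \<chi> j. of_real (\<rho> / 2))"
  have "z \<in> polydisc \<rho>" using assms(2) by (simp add: polydisc_def z_def)
  with assms(1) have "(\<lambda>k. H k * monomial z k) summable_on UNIV" by (simp add: A_space_def)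
  then have sm: "(\<lambda>k. cmod (H k * monomial z k)) summable_on UNIV"
    by (rule summable_on_iff_abs_summable_on_complex[THEN iffD1])
  have mono: "monomial z k = of_real ((\<rho> / 2) ^ mdegree k)" for k
    by (simp add: monomial_def z_def mdegree_def power_sum power_add)
  define S where "S = infsum (\<lambda>k. cmod (H k * monomial z k)) UNIV"
  have "degnorm H m \<le> S * (2 / \<rho>) ^ m" for m
  proof -
    have "degnorm H m * (\<rho> / 2) ^ m = (\<Sum>k | mdegree k = m. cmod (H k * monomial z k))"
      unfolding degnorm_def sum_distrib_right using assms(2)
      by (intro sum.cong) (auto simp: mono norm_mult simp del: of_real_power)
    also have "\<dots> \<le> S"
      unfolding S_def by (rule finite_sum_le_infsum[OF sm]) auto
    finally show ?thesis using assms(2) by (simp add: field_simps power_divide)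
  qed
  moreover have "S \<ge> 0" unfolding S_def by (intro infsum_nonneg) auto
  ultimately show ?thesis by blast
qed

lemma degnorm_le_imp_A_space:
  fixes H :: "'n::finite series"
  assumes H: "H \<in> F_diamond" and K: "K > 0" and bound: "\<And>r. degnorm H (r + 2) \<le> c * K ^ r"
  shows "H \<in> A_space (1 / (2 * K))"
proof -
  define g where "g = 1 / (2 * K)"
  have g: "g > 0" using K by (simp add: g_def)
  have c: "c \<ge> 0" using order.trans[OF degnorm_nonneg bound[of 0]] by simp
  \<comment> \<open>The radius is chosen so that \<open>K * g = 1 / 2\<close>; the factor 4
    compensates the shift from \<open>r\<close> to the degree \<open>m = r + 2\<close>.\<close>
  have m: "degnorm H m * g ^ m \<le> 4 * c * g ^ 2 * (1 / 2) ^ m" for m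
  proof (cases "m < 2")
    case True
    then show ?thesis using degnorm_eq_0[OF H, of m] c by simp
  next
    case False
    then obtain r where r: "m = r + 2" by (metis add.commute le_Suc_ex not_less)
    have "degnorm H m * g ^ m \<le> c * K ^ r * g ^ m"
      unfolding r using g by (intro mult_right_mono bound) auto
    also have "\<dots> = c * g ^ 2 * (K * g) ^ r" by (simp add: r power_add power_mult_distrib power2_eq_square)
    also have "K * g = 1 / 2" using K by (simp add: g_def)
    also have "c * g ^ 2 * (1 / 2) ^ r = 4 * c * g ^ 2 * (1 / 2) ^ m" by (simp add: r power_add)
    finally show ?thesis .
  qed
  \<comment> \<open>A finite set of indices lies below some degree \<open>M\<close>, so summing
    degree by degree bounds all partial sums uniformly.\<close>
  have fin: "(\<Sum>k\<in>X. cmod (H k) * g ^ mdegree k) \<le> 8 * c * g ^ 2" if X: "finite X" for X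
  proof -
    obtain M where M: "\<forall>k\<in>X. mdegree k \<le> M"
      using X by (metis finite_imageI finite_nat_set_iff_bounded_le imageI)
    have "(\<Sum>k\<in>X. cmod (H k) * g ^ mdegree k) \<le> (\<Sum>k | mdegree k \<le> M. cmod (H k) * g ^ mdegree k)"
      using M g by (intro sum_mono2 finite_mdegree_le) auto
    also have "\<dots> = (\<Sum>m\<le>M. \<Sum>k | k \<in> {k. mdegree k \<le> M} \<and> mdegree k = m. cmod (H k) * g ^ mdegree k)"
      by (rule sum.group[symmetric]) (auto intro: finite_mdegree_le)
    also have "\<dots> = (\<Sum>m\<le>M. degnorm H m * g ^ m)"
      unfolding degnorm_def sum_distrib_right by (intro sum.cong) auto
    also have "\<dots> \<le> (\<Sum>m\<le>M. 4 * c * g ^ 2 * (1 / 2) ^ m)" by (intro sum_mono m)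
    also have "\<dots> = 4 * c * g ^ 2 * (\<Sum>m\<le>M. (1 / 2) ^ m)" by (simp flip: sum_distrib_left)
    also have "\<dots> \<le> 4 * c * g ^ 2 * 2"
    proof (rule mult_left_mono)
      have "(\<Sum>m\<le>M. (1 / 2 :: real) ^ m) = 2 - (1 / 2) ^ M" by (induction M) auto
      then show "(\<Sum>m\<le>M. (1 / 2 :: real) ^ m) \<le> 2" by simp
    qed (use c in auto)
    finally show ?thesis by simp
  qed
  have sm: "(\<lambda>k. cmod (H k) * g ^ mdegree k) summable_on UNIV"
    by (rule nonneg_bdd_above_summable_on) (use g fin in \<open>auto intro!: bdd_aboveI\<close>)
  \<comment> \<open>On the polydisc one summable family, independent of \<open>z\<close>, dominates
    the terms; it yields both convergence and the bound on the supremum.\<close>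
  have le: "cmod (H k * monomial z k) \<le> cmod (H k) * g ^ mdegree k" if "z \<in> polydisc g" for z k
    using norm_monomial_le[OF that] by (simp add: norm_mult mult_left_mono)
  have abs: "(\<lambda>k. cmod (H k * monomial z k)) summable_on UNIV" if "z \<in> polydisc g" for z
    by (rule summable_on_comparison_test[OF sm]) (use le[OF that] in auto)
  have "cmod (series_eval H z) \<le> infsum (\<lambda>k. cmod (H k) * g ^ mdegree k) UNIV" if "z \<in> polydisc g" for z
    unfolding series_eval_def
    by (rule order.trans[OF norm_infsum_bound[OF abs[OF that]]])
       (intro infsum_mono abs[OF that] sm le[OF that])
  then have "bdd_above ((\<lambda>z. cmod (series_eval H z)) ` polydisc g)"
    by (auto intro!: bdd_aboveI)
  then show ?thesis
    using abs_summable_summable[OF abs] unfolding A_space_def g_def by auto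
qed

theorem theorem3:
  fixes \<omega> :: "real ^ 'n" and \<rho> :: real and H0 :: "'n series"
  assumes "nonresonant \<omega>"
    and "\<rho> > 0"
    and "H0 \<in> A_space \<rho> \<inter> F_diamond"
  shows "\<exists>(g :: real \<Rightarrow> real) A B. A > 0 \<and> B > 0 \<and>
           (\<forall>\<delta>\<ge>0. phi \<omega> \<delta> H0 \<in> A_space (g \<delta>) \<inter> F_diamond \<and>
                  g \<delta> \<ge> A / (1 + B * \<delta>))"
proof -
  from assms(3) obtain H where H: "flow_solution \<omega> H0 H"
    using flow_solution_exists by blast
  from A_space_imp_degnorm_le[of H0 \<rho>] assms obtain S
    where S: "S \<ge> 0" "\<And>m. degnorm H0 m \<le> S * (2 / \<rho>) ^ m" by auto
  \<comment> \<open>The factor \<open>(2 / \<rho>)\<^sup>2\<close> in \<open>c\<close> absorbs the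
    degree shift, and the summand 1 keeps \<open>c\<close> positive. \<open>R\<close> is 8 times
    \<open>2 / \<rho>\<close>, where the 8 pays for the weight through
    \<open>r\<^sup>3 \<le> 8\<^sup>r\<close>.\<close>
  define c R B where "c = S * (2 / \<rho>) ^ 2 + 1" and "R = 16 / \<rho>" and "B = 288 * real CARD('n) * c"
  have c: "c > 0" using S(1) by (simp add: c_def add_nonneg_pos)
  have R: "R > 0" using assms(2) by (simp add: R_def)
  have B: "B > 0" using c by (simp add: B_def)
  have init: "degnorm H0 (r + 2) \<le> c * R ^ r / real r ^ 3" for r
  proof (cases "r = 0")
    case True
    then show ?thesis using degnorm_eq_0[of H0 "r + 2"] assms(3) by simp
  next
    case False
    have "real r < 2 ^ r" by (rule of_nat_less_two_power)
    then have "real r ^ 3 \<le> (2 ^ r) ^ 3" by (intro power_mono) auto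
    also have "\<dots> = (8 :: real) ^ r" by (simp flip: power_mult add: mult.commute[of r]) (simp add: power_mult)
    finally have r3: "real r ^ 3 \<le> 8 ^ r" .
    have "degnorm H0 (r + 2) \<le> S * (2 / \<rho>) ^ (r + 2)" by (rule S(2))
    also have "\<dots> = S * (2 / \<rho>) ^ 2 * (R / 8) ^ r" by (simp add: power_add R_def power_divide power2_eq_square)
    also have "\<dots> \<le> c * (R / 8) ^ r" using R by (intro mult_right_mono) (auto simp: c_def)
    also have "\<dots> = c * R ^ r / 8 ^ r" by (simp add: power_divide)
    also have "\<dots> \<le> c * R ^ r / real r ^ 3"
      using r3 c R False by (intro divide_left_mono mult_pos_pos) auto
    finally show ?thesis .
  qed
  \<comment> \<open>This is the radius \<open>1 / (2 K)\<close> of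
    \<open>degnorm_le_imp_A_space\<close> for \<open>K = R (1 + B t)\<close>.\<close>
  define g where "g t = 1 / (2 * (R * (1 + B * t)))" for t
  have main: "phi \<omega> t H0 \<in> A_space (g t) \<inter> F_diamond" if t: "t \<ge> 0" for t
  proof -
    have F: "H t \<in> F_diamond" using H t by (simp add: flow_solution_def)
    have E: "1 + B * t \<ge> 1" using B t by simp
    have "degnorm (H t) (r + 2) \<le> c * (R * (1 + B * t)) ^ r" for r
    proof (cases "r = 0")
      case True
      then show ?thesis using degnorm_eq_0[OF F, of "r + 2"] c by simp
    next
      case False
      have "degnorm (H t) (r + 2) \<le> c * R ^ r * (1 + B * t) ^ (r - 1) / real r ^ 3"
        by (rule degnorm_flow_le[OF H _ _ B_def init t]) (use c R in auto)
      \<comment> \<open>Dropping \<open>r\<^sup>3 \<ge> 1\<close> and adding one factor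
        \<open>1 + B t \<ge> 1\<close> leaves a pure power.\<close>
      also have "\<dots> \<le> c * R ^ r * (1 + B * t) ^ r / 1"
        using False c R E by (intro frac_le mult_left_mono power_increasing) auto
      finally show ?thesis by (simp add: power_mult_distrib mult.assoc)
    qed
    then have "H t \<in> A_space (g t)"
      unfolding g_def using R E by (intro degnorm_le_imp_A_space[OF F]) auto
    with F show ?thesis using phi_eq[OF H t] by simp
  qed
  have "g t = (1 / (2 * R)) / (1 + B * t)" for t by (simp add: g_def)
  with main B R show ?thesis
    by (intro exI[of _ g] exI[of _ "1 / (2 * R)"] exI[of _ B]) auto
qed

end
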